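(* $n(3)=6$, where $n(k)$ denotes the minimum number of vertices in an oriented $k$-graph with Property O.
   Context: An oriented $k$-graph is a pair $\mathcal{H}=(V,\mathcal{E})$, where $V$ is a finite set (the vertex set) and $\mathcal{E}$ (the edge set) is a family of $k$-tuples of elements of $V$ such that no $k$-tuple in $\mathcal{E}$ has a repeated element, and no two $k$-tuples in $\mathcal{E}$ induce the same set (i.e. distinct $k$-tuples in $\mathcal{E}$ have distinct underlying $k$-element subsets of $V$). A tuple $(x_1,x_2,\ldots,x_\ell)$ of distinct elements of $V$ is said to be consistent with a linear order $<$ on $V$ if $x_1<x_2<\cdots<x_\ell$. An oriented $k$-graph $\mathcal{H}=(V,\mathcal{E})$ has Property O if for every linear order $<$ of $V$ there exists an edge $\vec{e}\in\mathcal{E}$ that is consistent with $<$. For $k\ge 2$, \[ n(k) := \min\{|V| : \text{there exists an oriented } k\text{-graph } \mathcal{H}=(V,\mathcal{E}) \text{ having Property O}\}. \] *)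

theory Defs
  imports Main
begin

text \<open>An oriented \<open>k\<close>-graph is given by its vertex set and its edge set; \<open>k\<close>-tuples are lists of
  length \<open>k\<close>.\<close>

definition oriented_graph :: "nat \<Rightarrow> 'a set \<Rightarrow> 'a list set \<Rightarrow> bool" where
  "oriented_graph k V E \<longleftrightarrow>
     finite V \<and>
     (\<forall>e\<in>E. length e = k \<and> set e \<subseteq> V \<and> distinct e) \<and>
     (\<forall>e\<in>E. \<forall>f\<in>E. set e = set f \<longrightarrow> e = f)"

text \<open>The library predicate \<open>linear_order_on\<close> describes reflexive orders, so \<open>x < y\<close> reads as
  \<open>(x, y) \<in> r \<and> x \<noteq> y\<close>.\<close>

definition consistent :: "'a rel \<Rightarrow> 'a list \<Rightarrow> bool" where
  "consistent r xs \<longleftrightarrow> sorted_wrt (\<lambda>x y. (x, y) \<in> r \<and> x \<noteq> y) xs"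

definition property_O :: "'a set \<Rightarrow> 'a list set \<Rightarrow> bool" where
  "property_O V E \<longleftrightarrow> (\<forall>r. linear_order_on V r \<longrightarrow> (\<exists>e\<in>E. consistent r e))"

text \<open>The possible numbers of vertices, with vertices taken from a given type. Every finite set can
  be relabelled by natural numbers, so \<^typ>\<open>nat\<close> is a sufficient vertex type for the minimum; see
  \<open>property_O_sizes_subset_nat\<close> below.\<close>

definition property_O_sizes :: "'a itself \<Rightarrow> nat \<Rightarrow> nat set" where
  "property_O_sizes _ k = {card V |(V :: 'a set) E. oriented_graph k V E \<and> property_O V E}"

text \<open>The value \<open>0\<close> in the case of an empty set is a placeholder that cannot be confused with a
  minimum: for \<open>k \<ge> 1\<close> no oriented \<open>k\<close>-graph on the empty vertex set has Property O.\<close>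

definition min_vertices :: "nat \<Rightarrow> nat" where
  "min_vertices k =
     (if property_O_sizes TYPE(nat) k = {} then 0
      else LEAST m. m \<in> property_O_sizes TYPE(nat) k)"

lemma property_O_relabel:
  assumes G: "oriented_graph k V E" and P: "property_O V E" and inj: "inj_on h V"
  shows "oriented_graph k (h ` V) (map h ` E)" and "property_O (h ` V) (map h ` E)"
proof -
  have sub: "set e \<subseteq> V" if "e \<in> E" for e
    using G that by (auto simp: oriented_graph_def)
  have eqD: "e = f" if "e \<in> E" "f \<in> E" "h ` set e = h ` set f" for e f
  proof -
    have "set e = set f"
      using inj_on_image_eq_iff[OF inj sub[OF that(1)] sub[OF that(2)]] that(3) by simp
    then show ?thesis using G that by (auto simp: oriented_graph_def)
  qed
  have "length e = k \<and> set e \<subseteq> h ` V \<and> distinct e" if e: "e \<in> map h ` E" for e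
  proof -
    from e obtain d where d: "d \<in> E" "e = map h d" by blast
    have "inj_on h (set d)" using inj sub[OF d(1)] by (rule inj_on_subset)
    then show ?thesis using d G sub[OF d(1)] by (auto simp: oriented_graph_def distinct_map)
  qed
  moreover have "e = f" if ef: "e \<in> map h ` E" "f \<in> map h ` E" "set e = set f" for e f
  proof -
    from ef obtain c d where "c \<in> E" "e = map h c" "d \<in> E" "f = map h d" by blast
    then show ?thesis using eqD[of c d] ef(3) by simp
  qed
  moreover have "finite (h ` V)" using G by (simp add: oriented_graph_def)
  ultimately show "oriented_graph k (h ` V) (map h ` E)"
    unfolding oriented_graph_def by blast
  show "property_O (h ` V) (map h ` E)"
    unfolding property_O_def
  proof (intro allI impI)
    fix r assume r: "linear_order_on (h ` V) r"
    define s where "s = {(x, y). x \<in> V \<and> y \<in> V \<and> (h x, h y) \<in> r}"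
    have "refl_on V s"
      using r by (auto simp: s_def refl_on_def order_on_defs)
    moreover have "s \<subseteq> V \<times> V" by (auto simp: s_def)
    moreover have "trans s"
    proof (rule transI)
      fix x y z assume a: "(x, y) \<in> s" "(y, z) \<in> s"
      have "trans r" using r by (simp add: order_on_defs)
      then show "(x, z) \<in> s" using a by (auto simp: s_def dest: transD)
    qed
    moreover have "antisym s"
    proof (rule antisymI)
      fix x y assume a: "(x, y) \<in> s" "(y, x) \<in> s"
      have "antisym r" using r by (simp add: order_on_defs)
      then have "h x = h y" using a by (auto simp: s_def dest: antisymD)
      then show "x = y" using inj a by (auto simp: s_def dest: inj_onD)
    qed
    moreover have "total_on V s"
      using r inj by (auto simp: s_def total_on_def order_on_defs dest: inj_onD)
    ultimately have "linear_order_on V s" by (simp add: order_on_defs)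
    with P obtain e where e: "e \<in> E" "consistent s e" by (auto simp: property_O_def)
    have "sorted_wrt (\<lambda>x y. (h x, h y) \<in> r \<and> h x \<noteq> h y) e"
      using e(2) unfolding consistent_def
      by (rule sorted_wrt_mono_rel[rotated]) (use inj in \<open>auto simp: s_def dest: inj_onD\<close>)
    then have "consistent r (map h e)" by (simp add: consistent_def sorted_wrt_map)
    with e(1) show "\<exists>e\<in>map h ` E. consistent r e" by blast
  qed
qed

lemma property_O_sizes_subset_nat:
  "property_O_sizes TYPE('a) k \<subseteq> property_O_sizes TYPE(nat) k"
proof
  fix m assume "m \<in> property_O_sizes TYPE('a) k"
  then obtain V :: "'a set" and E where
    VE: "m = card V" "oriented_graph k V E" "property_O V E"
    by (auto simp: property_O_sizes_def)
  then have "finite V" by (simp add: oriented_graph_def)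
  then obtain h :: "'a \<Rightarrow> nat" where h: "inj_on h V"
    using finite_imp_inj_to_nat_seg by blast
  have "card (h ` V) = m" using h VE(1) by (simp add: card_image)
  then show "m \<in> property_O_sizes TYPE(nat) k"
    using property_O_relabel[OF VE(2,3) h] unfolding property_O_sizes_def by blast
qed

end

(* Lower bound.  Five vertices span at most ten edges, so some vertex v comes first in at most two of
   them.  These edges (v, x, y) are arcs x -> y on the other four vertices, and up to relabelling
   two arcs form a path, a matching, or a pair with common tail or common head.  For each of the
   four shapes it is a propositional contradiction that each of the 120 orders contains an edge.
   (Counting alone does not suffice: ten edges, each consistent with 20 orders, could cover 120.)

   Upper bound.  Under the rotation of the integers modulo 6, the orbits of (0, 1, 3) and (0, 3, 2)
   together form an oriented 3-graph with Property O. *)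

theory Submission
  imports Defs
begin

section \<open>Linear orders given by lists\<close>

text \<open>Reflexive, to match \<open>linear_order_on\<close>: entries ascend from left to right,
  so every permutation of the vertices becomes an order to test \<open>property_O\<close>
  against.\<close>

primrec list_order :: "'a list \<Rightarrow> 'a rel" where
  "list_order [] = {}"
| "list_order (x # xs) = {x} \<times> set (x # xs) \<union> list_order xs"

lemma list_order_subset: "list_order xs \<subseteq> set xs \<times> set xs"
  by (induction xs) auto

lemma linear_order_on_list_order:
  "distinct xs \<Longrightarrow> linear_order_on (set xs) (list_order xs)"
proof (induction xs)
  case Nil
  then show ?case by (simp add: order_on_defs)
next
  case (Cons x xs)
  then have IH: "linear_order_on (set xs) (list_order xs)" and x: "x \<notin> set xs" by auto
  show ?case
    unfolding order_on_defs
  proof (intro conjI)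
    show "list_order (x # xs) \<subseteq> set (x # xs) \<times> set (x # xs)"
      by (rule list_order_subset)
    show "refl_on (set (x # xs)) (list_order (x # xs))"
      using IH by (auto simp: order_on_defs refl_on_def)
    show "trans (list_order (x # xs))"
      using IH x list_order_subset[of xs] unfolding order_on_defs trans_def by auto
    show "antisym (list_order (x # xs))"
      using IH x list_order_subset[of xs] unfolding order_on_defs antisym_def by auto
    show "total_on (set (x # xs)) (list_order (x # xs))"
      using IH by (auto simp: order_on_defs total_on_def)
  qed
qed

text \<open>This turns consistency with an explicit order into membership in a finite list. By
  induction: the head of \<open>xs\<close> is the least element, so \<open>ys\<close> either starts
  with it or avoids it.\<close>

lemma consistent_list_order_imp_subseq:
  "consistent (list_order xs) ys \<Longrightarrow> distinct xs \<Longrightarrow> set ys \<subseteq> set xs \<Longrightarrow> ys \<in> set (subseqs xs)"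
proof (induction xs arbitrary: ys)
  case Nil
  then show ?case by simp
next
  case (Cons x xs)
  have tail: "zs \<in> set (subseqs xs)"
    if "consistent (list_order (x # xs)) zs" "set zs \<subseteq> set xs" for zs
  proof (rule Cons.IH)
    show "consistent (list_order xs) zs"
      using that Cons.prems(2) unfolding consistent_def
      by (elim sorted_wrt_mono_rel[rotated]) auto
  qed (use that Cons.prems in auto)
  show ?case
  proof (cases ys)
    case Nil
    then show ?thesis using tail[of "[]"] by (simp add: consistent_def Let_def)
  next
    case (Cons z zs)
    \<comment> \<open>The only pair of the order that ends in \<open>x\<close> is
      \<open>(x, x)\<close>, so nothing precedes \<open>x\<close> strictly.\<close>
    have xs: "x \<notin> set zs"
      using Cons.prems Cons list_order_subset[of xs] by (auto simp: consistent_def)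
    then have "zs \<in> set (subseqs xs)"
      using tail[of zs] Cons.prems Cons by (auto simp: consistent_def)
    moreover have "ys \<in> set (subseqs xs)" if "z \<noteq> x"
      using tail[of ys] that xs Cons.prems Cons by auto
    ultimately show ?thesis using Cons by (auto simp: Let_def)
  qed
qed

text \<open>A linear order on the larger set restricts to one on \<open>V\<close>, and an edge
  consistent with the restriction is consistent with the whole. This permits padding by isolated
  vertices.\<close>

lemma property_O_mono:
  assumes "property_O V E" "V \<subseteq> V'"
  shows "property_O V' E"
  unfolding property_O_def
proof (intro allI impI)
  fix r assume r: "linear_order_on V' r"
  have "linear_order_on V (Restr r V)"
    using r assms(2) unfolding order_on_defs refl_on_def trans_def antisym_def total_on_def
    by (auto 4 4)
  then obtain e where e: "e \<in> E" "consistent (Restr r V) e"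
    using assms(1) by (auto simp: property_O_def)
  have "consistent r e"
    using e(2) unfolding consistent_def by (rule sorted_wrt_mono_rel[rotated]) auto
  then show "\<exists>e\<in>E. consistent r e" using e(1) by blast
qed

section \<open>The propositional core on five points, and the shapes of two arcs\<close>

text \<open>\<open>P x y z\<close> says that \<open>(x, y, z)\<close> is an edge, and \<open>D\<close> runs through the normal forms of the arcs
  left by the edges that start with vertex \<open>0\<close>.\<close>

lemma five_point_cover_first_arcs:
  fixes P :: "nat \<Rightarrow> nat \<Rightarrow> nat \<Rightarrow> bool"
  assumes cover: "\<forall>p\<in>{0,1,2,3,4}. \<forall>q\<in>{0,1,2,3,4}-{p}. \<forall>r\<in>{0,1,2,3,4}-{p,q}.
      \<forall>s\<in>{0,1,2,3,4}-{p,q,r}. \<forall>t\<in>{0,1,2,3,4}-{p,q,r,s}.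
        P p q r \<or> P p q s \<or> P p q t \<or> P p r s \<or> P p r t \<or> P p s t \<or> P q r s \<or> P q r t \<or>
        P q s t \<or> P r s t"
    and unique: "\<forall>p\<in>{0,1,2,3,4}. \<forall>q\<in>{0,1,2,3,4}-{p}. \<forall>r\<in>{0,1,2,3,4}-{p,q}.
      P p q r \<longrightarrow> \<not> P p r q \<and> \<not> P q p r \<and> \<not> P q r p \<and> \<not> P r p q \<and> \<not> P r q p"
    and D: "D \<in> {{(1,2),(2,3)}, {(1,2),(3,4)}, {(1,2),(1,3)}, {(1,3),(2,3)}}"
  shows "\<exists>x\<in>{1,2,3,4}. \<exists>y\<in>{1,2,3,4}-{x}. P 0 x y \<and> (x, y) \<notin> D"
proof -
  \<comment> \<open>Expanding the bounded quantifiers leaves ground clauses: one for each of the 120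
    orders, and the uniqueness clauses for each triple.\<close>
  note facts = cover[simplified insert_Diff_if, simplified] unique[simplified insert_Diff_if, simplified]
  consider "D = {(1,2),(2,3)}" | "D = {(1,2),(3,4)}" | "D = {(1,2),(1,3)}" | "D = {(1,3),(2,3)}"
    using D by blast
  then show ?thesis
  proof cases
    case 1
    show ?thesis unfolding 1 insert_Diff_if by (simp, use facts in sat)
  next
    case 2
    show ?thesis unfolding 2 insert_Diff_if by (simp, use facts in sat)
  next
    case 3
    show ?thesis unfolding 3 insert_Diff_if by (simp, use facts in sat)
  next
    case 4
    show ?thesis unfolding 4 insert_Diff_if by (simp, use facts in sat)
  qed
qed

text \<open>Two distinct arcs that are not opposite share at most one vertex, and its role as head
  or tail in each arc decides the shape. Inclusion instead of equality lets fewer than two arcs fall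
  under the same shapes.\<close>

lemma two_arcs_normal_form:
  assumes W: "card W = 4" and D: "D \<subseteq> W \<times> W" "card D \<le> 2"
    and asym: "\<And>x y. (x, y) \<in> D \<Longrightarrow> (y, x) \<notin> D"
  obtains a b c d where "distinct [a, b, c, d]" "W = {a, b, c, d}"
    "D \<subseteq> {(a, b), (b, c)} \<or> D \<subseteq> {(a, b), (c, d)} \<or> D \<subseteq> {(a, b), (a, c)} \<or> D \<subseteq> {(a, c), (b, c)}"
proof -
  have fin: "finite W" using W by (metis card.infinite zero_neq_numeral)
  have ext: "\<exists>ys. length ys = 4 - length xs \<and> distinct (xs @ ys) \<and> W = set (xs @ ys)"
    if xs: "distinct xs" "set xs \<subseteq> W" for xs
  proof -
    obtain ys where "set ys = W - set xs" "distinct ys"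
      using finite_distinct_list[of "W - set xs"] fin by auto
    moreover have "length ys = 4 - length xs"
      using calculation xs W fin by (metis List.finite_set card_Diff_subset distinct_card)
    ultimately show ?thesis using xs by (intro exI[of _ ys]) auto
  qed
  have ext2: "\<exists>c d. distinct [a, b, c, d] \<and> W = {a, b, c, d}" if "a \<noteq> b" "a \<in> W" "b \<in> W" for a b
    using ext[of "[a, b]"] that by (fastforce simp: length_Suc_conv numeral_eq_Suc)
  have ext3: "\<exists>d. distinct [a, b, c, d] \<and> W = {a, b, c, d}"
    if "distinct [a, b, c]" "a \<in> W" "b \<in> W" "c \<in> W" for a b c
    using ext[of "[a, b, c]"] that by (fastforce simp: length_Suc_conv numeral_eq_Suc)
  have ext4: "W = {a, b, c, d}" if "distinct [a, b, c, d]" "a \<in> W" "b \<in> W" "c \<in> W" "d \<in> W" for a b c d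
    using ext[of "[a, b, c, d]"] that by auto
  consider "D = {}" | e where "D = {e}" | e f where "e \<noteq> f" "D = {e, f}"
  proof -
    have "finite D" using D(1) fin by (auto intro: finite_subset)
    moreover have "card D = 0 \<or> card D = 1 \<or> card D = 2" using D(2) by linarith
    ultimately show thesis
      using that by (metis card_0_eq card_1_singletonE card_2_iff)
  qed
  then show thesis
  proof cases
    case 1
    obtain ys where "length ys = 4" "distinct ys" "W = set ys" using ext[of "[]"] by auto
    then obtain a b c d where "distinct [a, b, c, d]" "W = {a, b, c, d}"
      by (auto simp: length_Suc_conv numeral_eq_Suc)
    then show thesis using that 1 by blast
  next
    case (2 e)
    obtain p q where e: "e = (p, q)" by fastforce
    \<comment> \<open>A loop would be its own reversal, so \<open>asym\<close> excludes it.\<close>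
    then have "p \<noteq> q" "p \<in> W" "q \<in> W" using 2 D(1) asym[of p q] by auto
    then show thesis using ext2[of p q] that 2 e by blast
  next
    case (3 e f)
    obtain p q r s where ef: "e = (p, q)" "f = (r, s)" by fastforce
    then have *: "p \<noteq> q" "p \<in> W" "q \<in> W" "r \<noteq> s" "r \<in> W" "s \<in> W" "p = s \<longrightarrow> q \<noteq> r" "(p,q) \<noteq> (r,s)"
      using 3 D(1) asym[of p q] asym[of r s] by auto
    \<comment> \<open>Either arc can be the first one of a path, hence two path cases; then common
      tail, common head, and matching.\<close>
    consider "q = r" "p \<noteq> s" | "p = s" "q \<noteq> r" | "p = r" "q \<noteq> s" | "q = s" "p \<noteq> r" | "distinct [p, q, r, s]"
      using * by auto
    then show thesis
    proof cases
      case 1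
      then obtain t where "distinct [p, q, s, t]" "W = {p, q, s, t}"
        using ext3[of p q s] * by auto
      then show thesis using that[of p q s t] 1 \<open>D = {e, f}\<close> ef by simp
    next
      case 2
      then obtain t where "distinct [r, s, q, t]" "W = {r, s, q, t}"
        using ext3[of r s q] * by auto
      then show thesis using that[of r s q t] 2 \<open>D = {e, f}\<close> ef by simp
    next
      case 3
      then obtain t where "distinct [p, q, s, t]" "W = {p, q, s, t}"
        using ext3[of p q s] * by auto
      then show thesis using that[of p q s t] 3 \<open>D = {e, f}\<close> ef by simp
    next
      case 4
      then obtain t where "distinct [p, r, q, t]" "W = {p, r, q, t}"
        using ext3[of p r q] * by auto
      then show thesis using that[of p r q t] 4 \<open>D = {e, f}\<close> ef by simp
    next
      case 5
      then have "W = {p, q, r, s}" using ext4[of p q r s] * by simp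
      then show thesis using that[of p q r s] 5 \<open>D = {e, f}\<close> ef by simp
    qed
  qed
qed

section \<open>The construction on six vertices\<close>

lemma six_in_property_O_sizes: "6 \<in> property_O_sizes TYPE(nat) 3"
proof -
  define V :: "nat set" where "V = {0,1,2,3,4,5}"
  \<comment> \<open>One orbit per row. The cyclic gaps 1, 2, 3 of {0, 1, 3} and 2, 1, 3 of {0, 2, 3}
    are not rotations of each other, so the twelve underlying sets differ.\<close>
  define E where "E = {[0,1,3], [1,2,4], [2,3,5], [3,4,0], [4,5,1], [5,0,2],
    [0,3,2], [1,4,3], [2,5,4], [3,0,5], [4,1,0], [5,2,1::nat]}"
  have "oriented_graph 3 V E"
    unfolding oriented_graph_def
  proof (intro conjI)
    show "finite V" by (simp add: V_def)
    show "\<forall>e\<in>E. length e = 3 \<and> set e \<subseteq> V \<and> distinct e" by (simp add: V_def E_def)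
    show "\<forall>e\<in>E. \<forall>f\<in>E. set e = set f \<longrightarrow> e = f"
      unfolding E_def by (simp add: set_eq_subset)
  qed
  moreover have "property_O V E"
    unfolding property_O_def
  proof (intro allI impI)
    fix r assume r: "linear_order_on V r"
    define L where "L x y \<longleftrightarrow> (x, y) \<in> r \<and> x \<noteq> y" for x y
    have "\<forall>x\<in>V. \<forall>y\<in>V-{x}. L x y \<or> L y x"
      using r by (auto simp: order_on_defs total_on_def L_def)
    note total = this[unfolded V_def, simplified insert_Diff_if, simplified]
    have L_trans: "L x z" if "L x y" "L y z" for x y z
      using r that unfolding order_on_defs L_def by (metis antisymD transD)
    have "\<forall>x\<in>V. \<forall>y\<in>V-{x}. \<forall>z\<in>V-{x,y}. L x y \<longrightarrow> L y z \<longrightarrow> L x z"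
      using L_trans by blast
    note trans = this[unfolded V_def, simplified insert_Diff_if, simplified]
    have "\<forall>x\<in>V. \<forall>y\<in>V-{x}. L x y \<longrightarrow> \<not> L y x"
      using r unfolding order_on_defs L_def by (auto dest: antisymD)
    note asym = this[unfolded V_def, simplified insert_Diff_if, simplified]
    \<comment> \<open>A strict linear order is a transitive tournament, so this is propositional in
      the values of \<open>L\<close>. The third comparison needed for consistency follows by
      transitivity.\<close>
    have "\<exists>e\<in>E. L (e!0) (e!1) \<and> L (e!1) (e!2)"
      unfolding E_def by (simp, use total trans asym in sat)
    moreover have "consistent r e" if "e \<in> E" "L (e!0) (e!1)" "L (e!1) (e!2)" for e
    proof -
      have "L (e!0) (e!2)" using L_trans that by blast
      with that show ?thesis
        by (auto simp: consistent_def L_def E_def)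
    qed
    ultimately show "\<exists>e\<in>E. consistent r e" by blast
  qed
  ultimately show ?thesis
    unfolding property_O_sizes_def by (intro CollectI exI[of _ V] exI[of _ E]) (simp add: V_def)
qed

section \<open>Excluding five vertices\<close>

lemma oriented_graph_finite_edges:
  assumes "oriented_graph k V E"
  shows "finite E"
proof (rule inj_on_finite)
  show "inj_on set E" "set ` E \<subseteq> Pow V" "finite (Pow V)"
    using assms by (auto simp: oriented_graph_def inj_on_def)
qed

text \<open>Grouping the edges by first vertex, at least three for each vertex would give 15 edges,
  more than \<open>5 choose 3\<close>.\<close>

lemma ex_vertex_first_in_at_most_two_edges:
  assumes G: "oriented_graph 3 V E" and V: "card V = 5"
  obtains v where "v \<in> V" "card {e \<in> E. hd e = v} \<le> 2"
proof -
  have finV: "finite V" using G by (simp add: oriented_graph_def)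
  have e3: "length e = 3 \<and> set e \<subseteq> V \<and> distinct e" if "e \<in> E" for e
    using G that by (simp add: oriented_graph_def)
  have inj: "inj_on set E" using G by (auto simp: oriented_graph_def inj_on_def)
  have sub: "set ` E \<subseteq> {A. A \<subseteq> V \<and> card A = 3}"
    using e3 by (auto simp: distinct_card)
  have fin: "finite {A. A \<subseteq> V \<and> card A = 3}" using finV by simp
  have finE: "finite E" using G by (rule oriented_graph_finite_edges)
  have "card E \<le> 5 choose 3"
    using card_inj_on_le[OF inj sub fin] n_subsets[OF finV, of 3] V by simp
  also have "5 choose 3 = (10 :: nat)" by (simp add: numeral_eq_Suc)
  finally have "card E \<le> 10" .
  moreover have "(\<Sum>v\<in>V. card {e \<in> E. hd e = v}) = card E"
  proof -
    have "hd ` E \<subseteq> V"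
    proof (rule image_subsetI)
      fix e assume "e \<in> E"
      then show "hd e \<in> V" using e3[of e] by (cases e) auto
    qed
    then show ?thesis using sum.group[OF finE finV, of hd "\<lambda>_. 1 :: nat"] by simp
  qed
  moreover have "(\<Sum>v\<in>V. card {e \<in> E. hd e = v}) \<ge> 15"
    if "\<forall>v\<in>V. card {e \<in> E. hd e = v} \<ge> 3"
    using sum_mono[of V "\<lambda>_. 3" "\<lambda>v. card {e \<in> E. hd e = v}"] that V by simp
  ultimately have "\<exists>v\<in>V. \<not> card {e \<in> E. hd e = v} \<ge> 3" by fastforce
  then show thesis using that by force
qed

text \<open>The arcs at a vertex \<open>v\<close> that is first in at most two edges fit into one of
  the four shapes, yet \<open>five_point_cover_first_arcs\<close> produces an arc outside each
  shape.\<close>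

lemma not_property_O_five:
  assumes G: "oriented_graph 3 V E" and V: "card V = 5"
  shows "\<not> property_O V E"
proof
  assume O: "property_O V E"
  obtain v where v: "v \<in> V" "card {e \<in> E. hd e = v} \<le> 2"
    using ex_vertex_first_in_at_most_two_edges[OF G V] .
  have finE: "finite E" using G by (rule oriented_graph_finite_edges)
  have edge: "distinct [p, q, r] \<and> {p, q, r} \<subseteq> V" if "[p, q, r] \<in> E" for p q r
    using G that by (force simp: oriented_graph_def)
  have same: "[p, q, r] = [p', q', r']"
    if "[p, q, r] \<in> E" "[p', q', r'] \<in> E" "{p, q, r} = {p', q', r'}" for p q r p' q' r'
    using G that unfolding oriented_graph_def by (metis empty_set list.simps(15))
  define D where "D = {(x, y). [v, x, y] \<in> E}"
  have "(\<lambda>(x, y). [v, x, y]) ` D \<subseteq> {e \<in> E. hd e = v}" by (auto simp: D_def)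
  moreover have "inj_on (\<lambda>(x, y). [v, x, y]) D" by (auto simp: inj_on_def)
  ultimately have "card D \<le> card {e \<in> E. hd e = v}"
    using finE by (intro card_inj_on_le) auto
  then have cardD: "card D \<le> 2" using v(2) by simp
  have W: "card (V - {v}) = 4" using V v(1) by simp
  have DW: "D \<subseteq> (V - {v}) \<times> (V - {v})" using edge by (auto simp: D_def)
  have asym: "(y, x) \<notin> D" if "(x, y) \<in> D" for x y
    using that same[of v x y v y x] edge[of v x y] by (auto simp: D_def)
  obtain a b c d where abcd: "distinct [a, b, c, d]" "V - {v} = {a, b, c, d}"
    and arcs: "D \<subseteq> {(a, b), (b, c)} \<or> D \<subseteq> {(a, b), (c, d)} \<or> D \<subseteq> {(a, b), (a, c)} \<or>
      D \<subseteq> {(a, c), (b, c)}"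
    using two_arcs_normal_form[OF W DW cardD asym] by blast
  \<comment> \<open>The numbering sends \<open>0\<close> to \<open>v\<close> and \<open>1\<close> to
    \<open>4\<close> to the normal form, so the four index sets for \<open>S\<close> become the four
    alternatives in \<open>arcs\<close>.\<close>
  define w where "w i = [v, a, b, c, d] ! i" for i
  have w: "w 0 = v" "w 1 = a" "w 2 = b" "w 3 = c" "w 4 = d" by (simp_all add: w_def)
  have V_eq: "V = {v, a, b, c, d}" using abcd(2) v(1) by auto
  have dist: "distinct [v, a, b, c, d]" using abcd by auto
  have inj: "inj_on w {0,1,2,3,4}" using dist by (auto simp: inj_on_def w_def)
  have subseq: "\<exists>e\<in>E. e \<in> set (subseqs [p, q, r, s, t])"
    if "distinct [p, q, r, s, t]" "V = {p, q, r, s, t}" for p q r s t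
  proof -
    have "linear_order_on V (list_order [p, q, r, s, t])"
      using linear_order_on_list_order[OF that(1)] that(2) by simp
    then obtain e where "e \<in> E" "consistent (list_order [p, q, r, s, t]) e"
      using O by (auto simp: property_O_def)
    then show ?thesis
      using consistent_list_order_imp_subseq[OF _ that(1), of e] G that(2)
      by (auto simp: oriented_graph_def simp del: subseqs.simps)
  qed
  \<comment> \<open>The alternatives are the ten subsequences of length 3.\<close>
  have cover: "[p, q, r] \<in> E \<or> [p, q, s] \<in> E \<or> [p, q, t] \<in> E \<or> [p, r, s] \<in> E \<or> [p, r, t] \<in> E \<or>
      [p, s, t] \<in> E \<or> [q, r, s] \<in> E \<or> [q, r, t] \<in> E \<or> [q, s, t] \<in> E \<or> [r, s, t] \<in> E"
    if pqrst: "distinct [p, q, r, s, t]" "V = {p, q, r, s, t}" for p q r s t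
  proof -
    obtain e where "e \<in> E" "e \<in> set (subseqs [p, q, r, s, t])" using subseq[OF pqrst] by blast
    moreover have "length e = 3" using G \<open>e \<in> E\<close> by (simp add: oriented_graph_def)
    ultimately show ?thesis by (simp add: Let_def) (elim disjE; simp)
  qed
  define P where "P i j k \<longleftrightarrow> [w i, w j, w k] \<in> E" for i j k
  have other_arc: "\<exists>x\<in>{1,2,3,4}. \<exists>y\<in>{1,2,3,4}-{x}. P 0 x y \<and> (x, y) \<notin> S"
    if S: "S \<in> {{(1,2),(2,3)}, {(1,2),(3,4)}, {(1,2),(1,3)}, {(1,3),(2,3)}}" for S
  proof (rule five_point_cover_first_arcs[OF _ _ S]; intro ballI)
    fix p q r s t
    assume *: "p \<in> {0,1,2,3,4}" "q \<in> {0,1,2,3,4}-{p}" "r \<in> {0,1,2,3,4}-{p,q}"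
      "s \<in> {0,1,2,3,4}-{p,q,r}" "t \<in> {0,1,2,3,4::nat}-{p,q,r,s}"
    \<comment> \<open>Injectivity of \<open>w\<close> and a cardinality count show that five
      distinct indices enumerate all of \<open>V\<close>, so \<open>cover\<close> applies.\<close>
    have sub: "set [p, q, r, s, t] \<subseteq> {0,1,2,3,4}"
      using *(1) *(2-5)[THEN DiffD1] by (simp only: list.set insert_subset empty_subsetI simp_thms)
    have "distinct [p, q, r, s, t]"
      using *(2-5)[THEN DiffD2] by auto
    then have d: "distinct (map w [p, q, r, s, t])"
      unfolding distinct_map using inj_on_subset[OF inj sub] by blast
    have "w ` {0,1,2,3,4} = V" using w V_eq by simp
    then have "set (map w [p, q, r, s, t]) \<subseteq> V"
      using image_mono[OF sub, of w] by (simp only: list.set_map)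
    moreover have "card (set (map w [p, q, r, s, t])) = 5" using distinct_card[OF d] by simp
    ultimately have "set (map w [p, q, r, s, t]) = V"
      using V by (intro card_subset_eq) (auto simp: V_eq)
    then show "P p q r \<or> P p q s \<or> P p q t \<or> P p r s \<or> P p r t \<or> P p s t \<or> P q r s \<or> P q r t \<or>
        P q s t \<or> P r s t"
      using cover[of "w p" "w q" "w r" "w s" "w t"] d unfolding P_def by simp
  next
    fix p q r
    show "P p q r \<longrightarrow> \<not> P p r q \<and> \<not> P q p r \<and> \<not> P q r p \<and> \<not> P r p q \<and> \<not> P r q p"
    proof
      assume P: "P p q r"
      then have "distinct [w p, w q, w r]" using edge by (simp add: P_def)
      then show "\<not> P p r q \<and> \<not> P q p r \<and> \<not> P q r p \<and> \<not> P r p q \<and> \<not> P r q p"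
        using same[OF P[unfolded P_def]] unfolding P_def
        by (intro conjI notI) (fastforce simp: insert_commute)+
    qed
  qed
  \<comment> \<open>Since \<open>w\<close> is injective on the indices, an arc outside
    \<open>S\<close> is carried to an arc of \<open>D\<close> outside the image of
    \<open>S\<close>.\<close>
  have "\<not> D \<subseteq> map_prod w w ` S"
    if S: "S \<in> {{(1,2),(2,3)}, {(1,2),(3,4)}, {(1,2),(1,3)}, {(1,3),(2,3)}}" for S
  proof
    assume DS: "D \<subseteq> map_prod w w ` S"
    obtain x y where xy: "x \<in> {1,2,3,4}" "y \<in> {1,2,3,4}" "P 0 x y" "(x, y) \<notin> S"
      using other_arc[OF S] by blast
    then have "(w x, w y) \<in> map_prod w w ` S"
      using DS by (auto simp: P_def D_def w)
    then obtain x' y' where xy': "(x', y') \<in> S" "w x = w x'" "w y = w y'" by auto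
    have "S \<subseteq> {1,2,3,4} \<times> {1,2,3,4}" using S by (elim insertE) simp_all
    then have "x' \<in> {1,2,3,4}" "y' \<in> {1,2,3,4}" using xy'(1) by blast+
    then have "x = x'" "y = y'"
      using inj_onD[OF inj xy'(2)] inj_onD[OF inj xy'(3)] xy(1,2) by blast+
    then show False using xy(4) xy'(1) by simp
  qed
  from this[of "{(1,2),(2,3)}"] this[of "{(1,2),(3,4)}"] this[of "{(1,2),(1,3)}"]
    this[of "{(1,3),(2,3)}"] arcs
  \<comment> \<open>Keeping \<open>1\<close> unexpanded lets the equation \<open>w 1 = a\<close>
    rewrite.\<close>
  show False by (simp add: w del: One_nat_def)
qed

section \<open>The minimum\<close>

theorem mainTheorem2:
  shows "min_vertices 3 = 6"
proof -
  have "6 \<le> m" if m: "m \<in> property_O_sizes TYPE(nat) 3" for m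
  proof (rule ccontr)
    assume "\<not> 6 \<le> m"
    obtain V :: "nat set" and E where VE: "m = card V" "oriented_graph 3 V E" "property_O V E"
      using m unfolding property_O_sizes_def by blast
    have finV: "finite V" using VE(2) by (simp add: oriented_graph_def)
    \<comment> \<open>Fresh naturals pad \<open>V\<close> to exactly five vertices;
      \<open>5 - m\<close> is a true difference because \<open>m\<close> is at most 5.\<close>
    then have "infinite (UNIV - V)" by simp
    then obtain B where B: "finite B" "card B = 5 - m" "B \<subseteq> UNIV - V"
      using infinite_arbitrarily_large by blast
    have "card (V \<union> B) = 5"
      using card_Un_disjoint[OF finV B(1)] B \<open>\<not> 6 \<le> m\<close> VE(1) by auto
    moreover have "oriented_graph 3 (V \<union> B) E"
      using VE(2) B(1) unfolding oriented_graph_def by blast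
    moreover have "property_O (V \<union> B) E" using VE(3) by (rule property_O_mono) simp
    ultimately show False using not_property_O_five by blast
  qed
  then have "(LEAST m. m \<in> property_O_sizes TYPE(nat) 3) = 6"
    using six_in_property_O_sizes by (intro Least_equality)
  \<comment> \<open>Membership of \<open>6\<close> also rules out the placeholder value for the
    empty set.\<close>
  then show ?thesis using six_in_property_O_sizes by (auto simp: min_vertices_def)
qed

end
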